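(* Let $(\mathcal S,\mathcal A,\mu)$ be a $\sigma$-finite measure space, $p(s)\ge0$ a function with $\int_{\mathcal S}p(s)\,d\mu(s)=1$, and $P(A)=\int_Ap(s)\,d\mu(s)$, $A\in\mathcal A$. Let $f$ be a measurable function on $\mathcal S$ such that $I=\int_{\mathcal S}f(s)p(s)\,d\mu(s)$ exists, and let $\xi=f(s)$ be regarded as a random variable on $(\mathcal S,\mathcal A,P)$, so that $I=E\xi$. Let $\xi_i$, $i=1,\dots,n$, be independent copies of $\xi$ and $Z_n=\frac1n\sum_{i=1}^n\xi_i$. If $\xi$ belongs to the space $\mathbf F_\psi(\Omega)$, for which condition $\mathbf H$ with constant $C_\psi$ is satisfied, and $n$ is such that $$\inf_{u\ge1}\frac{2^u\widetilde L^u(\psi(u))^u}{(\sqrt n\,\varepsilon)^u}\le\delta,\qquad\widetilde L=\|\xi\|_\psi\sqrt{C_\psi},$$ then $Z_n$ approximates $I$ with reliability $1-\delta$ ($0<\delta<1$) and accuracy $\varepsilon>0$, i.e. $P\{|Z_n-I|>\varepsilon\}\le\delta$.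
   Context: $\psi(u)>0$, $u\ge1$, is a monotonically increasing continuous function with $\psi(u)\to\infty$ as $u\to\infty$. $\mathbf F_\psi(\Omega)$ is the Banach space of random variables with norm $\|\xi\|_\psi=\sup_{u\ge1}\frac{(E|\xi|^u)^{1/u}}{\psi(u)}<\infty$. Condition $\mathbf H$ with constant $C_\psi$: for any centered independent random variables $\xi_1,\dots,\xi_n$ from the space, $\|\sum_{i=1}^n\xi_i\|_\psi^2\le C_\psi\sum_{i=1}^n\|\xi_i\|_\psi^2$. *)

theory Defs
  imports "HOL-Probability.Probability"
begin

definition psi_norm :: "'w measure \<Rightarrow> (real \<Rightarrow> real) \<Rightarrow> ('w \<Rightarrow> real) \<Rightarrow> real" where
  "psi_norm M \<psi> \<xi> =
     (SUP u\<in>{1..}. (\<integral>\<omega>. \<bar>\<xi> \<omega>\<bar> powr u \<partial>M) powr (1 / u) / \<psi> u)"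

text \<open>
  Finiteness of the norm is spelled out as: every moment of order at least one is finite, and the
  normalised moments are bounded. Outside this set the real supremum above has no meaning.
  Random variables are functions here, not classes modulo almost sure equality.
\<close>

definition F_psi :: "'w measure \<Rightarrow> (real \<Rightarrow> real) \<Rightarrow> ('w \<Rightarrow> real) set" where
  "F_psi M \<psi> =
     {\<xi> \<in> borel_measurable M.
        (\<forall>u\<ge>1. integrable M (\<lambda>\<omega>. \<bar>\<xi> \<omega>\<bar> powr u)) \<and>
        bdd_above ((\<lambda>u. (\<integral>\<omega>. \<bar>\<xi> \<omega>\<bar> powr u \<partial>M) powr (1 / u) / \<psi> u) ` {1..})}"

definition condition_H :: "'w measure \<Rightarrow> (real \<Rightarrow> real) \<Rightarrow> real \<Rightarrow> bool" where
  "condition_H M \<psi> C \<longleftrightarrow>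
     (\<forall>(n::nat) (\<xi> :: nat \<Rightarrow> 'w \<Rightarrow> real).
        (\<forall>i\<in>{1..n}. \<xi> i \<in> F_psi M \<psi> \<and> (\<integral>\<omega>. \<xi> i \<omega> \<partial>M) = 0) \<longrightarrow>
        prob_space.indep_vars M (\<lambda>_. borel) \<xi> {1..n} \<longrightarrow>
        (psi_norm M \<psi> (\<lambda>\<omega>. \<Sum>i=1..n. \<xi> i \<omega>))\<^sup>2
          \<le> C * (\<Sum>i=1..n. (psi_norm M \<psi> (\<xi> i))\<^sup>2))"

end

theory Submission
  imports Defs
begin

text \<open>
  Up to the scale \<open>\<psi>\<close>, the norm controls all moments of order \<open>u \<ge> 1\<close> at once, so Markov's inequality
  may be applied with any such \<open>u\<close> and the best one kept. For a variable with mean \<open>I\<close> and norm \<open>K\<close>,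
  subtracting \<open>I\<close> costs at most a factor \<open>2\<close>: Jensen's inequality bounds \<open>\<bar>I\<bar>\<close> by the moments of the
  variable itself (\<open>psi_bounded_expectation\<close>), and Minkowski's inequality
  (\<open>moment_triangle_ineq\<close>) adds the two bounds. This factor is the \<open>2\<close> in the
  statement. Condition \<open>H\<close>, applied to the \<open>n\<close> centred copies \<open>\<xi>\<^sub>i - I\<close>, then gives
  \<open>\<parallel>\<Sum> (\<xi>\<^sub>i - I)\<parallel> \<le> sqrt (C n) 2 K = 2 L sqrt n\<close>: the norm of the sum grows like \<open>sqrt n\<close> and not
  like \<open>n\<close>. Dividing by \<open>n \<epsilon>\<close> in Markov's inequality leaves \<open>(2 L \<psi> u / (sqrt n \<epsilon>)) powr u\<close> for every
  \<open>u \<ge> 1\<close>, hence the infimum.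

  The norm is a real supremum, which carries information only when it is known to be bounded.
  The argument is therefore phrased with explicit bounds \<open>psi_bounded M \<psi> K X\<close>, which
  for \<open>K \<ge> 0\<close> mean \<open>\<parallel>X\<parallel> \<le> K\<close> with all moments of order \<open>u \<ge> 1\<close> finite. Such bounds depend only on the law of \<open>X\<close>, so
  they pass from \<open>f\<close> on the space of integration to the sampled copies.
\<close>

section \<open>Moments of order at least one\<close>

text \<open>
  On the open half line this is \<open>powr_convex\<close>; when an endpoint is \<open>0\<close> it amounts to
  \<open>t powr u \<le> t\<close> for \<open>t\<close> in the unit interval.
\<close>

lemma convex_on_powr_nonneg:
  assumes "u \<ge> (1::real)"
  shows "convex_on {0..} (\<lambda>x::real. x powr u)"
proof (rule convex_onI)
  have shrink: "(t * x) powr u \<le> t * x powr u" if "0 < t" "t < 1" for t x :: real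
  proof -
    have "t powr u \<le> t powr 1"
      using that assms by (intro powr_mono') auto
    then show ?thesis
      using that by (simp add: powr_mult mult_right_mono)
  qed
  fix t x y :: real
  assume t: "0 < t" "t < 1" and xy: "x \<in> {0..}" "y \<in> {0..}"
  show "((1 - t) *\<^sub>R x + t *\<^sub>R y) powr u \<le> (1 - t) * x powr u + t * y powr u"
  proof (cases "x = 0 \<or> y = 0")
    case True
    then show ?thesis
      using shrink[of t y] shrink[of "1 - t" x] t by auto
  next
    case False
    then show ?thesis
      using convex_onD[OF powr_convex[OF assms], of t x y] t xy by auto
  qed
qed auto

lemma convex_on_abs_powr:
  assumes "u \<ge> (1::real)"
  shows "convex_on UNIV (\<lambda>x::real. \<bar>x\<bar> powr u)"
proof (rule convex_onI)
  fix t x y :: real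
  assume t: "0 < t" "t < 1"
  have "\<bar>(1 - t) *\<^sub>R x + t *\<^sub>R y\<bar> \<le> (1 - t) * \<bar>x\<bar> + t * \<bar>y\<bar>"
    using t abs_triangle_ineq[of "(1 - t) * x" "t * y"] by (simp add: abs_mult)
  then have "\<bar>(1 - t) *\<^sub>R x + t *\<^sub>R y\<bar> powr u \<le> ((1 - t) * \<bar>x\<bar> + t * \<bar>y\<bar>) powr u"
    using assms by (intro powr_mono2) auto
  also have "\<dots> \<le> (1 - t) * \<bar>x\<bar> powr u + t * \<bar>y\<bar> powr u"
    using convex_onD[OF convex_on_powr_nonneg[OF assms], of t "\<bar>x\<bar>" "\<bar>y\<bar>"] t by auto
  finally show "\<bar>(1 - t) *\<^sub>R x + t *\<^sub>R y\<bar> powr u \<le> (1 - t) * \<bar>x\<bar> powr u + t * \<bar>y\<bar> powr u" .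
qed auto

text \<open>
  Writing \<open>(x + y) / (a + b)\<close> as the average of \<open>x / a\<close> and \<open>y / b\<close> with weights proportional to
  \<open>a\<close> and \<open>b\<close> makes convexity an inequality that integrates to Minkowski's.
\<close>

lemma abs_add_powr_le:
  fixes x y a b u :: real
  assumes "a > 0" "b > 0" "u \<ge> 1"
  shows "\<bar>x + y\<bar> powr u
    \<le> (a + b) powr u * (a / (a + b) * (\<bar>x\<bar> powr u / a powr u) + b / (a + b) * (\<bar>y\<bar> powr u / b powr u))"
proof -
  define t where "t = b / (a + b)"
  have t: "0 \<le> t" "t \<le> 1" "1 - t = a / (a + b)"
    using assms by (auto simp: t_def field_simps)
  have avg: "(1 - t) * (x / a) + t * (y / b) = (x + y) / (a + b)"
    using assms by (simp add: t(3)) (simp add: t_def add_divide_distrib)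
  have "\<bar>(x + y) / (a + b)\<bar> powr u \<le> (1 - t) * \<bar>x / a\<bar> powr u + t * \<bar>y / b\<bar> powr u"
    using convex_onD[OF convex_on_abs_powr[OF assms(3)], of t "x / a" "y / b"] t avg by simp
  then have "\<bar>x + y\<bar> powr u / (a + b) powr u
      \<le> (1 - t) * (\<bar>x\<bar> powr u / a powr u) + t * (\<bar>y\<bar> powr u / b powr u)"
    using assms by (simp add: powr_divide)
  then show ?thesis
    using assms unfolding t(3) by (simp add: t_def pos_divide_le_eq mult.commute)
qed

lemma integrable_abs_add_powr:
  fixes X Y :: "'a \<Rightarrow> real"
  assumes u: "u \<ge> 1"
    and [measurable]: "X \<in> borel_measurable M" "Y \<in> borel_measurable M"
    and X: "integrable M (\<lambda>\<omega>. \<bar>X \<omega>\<bar> powr u)" and Y: "integrable M (\<lambda>\<omega>. \<bar>Y \<omega>\<bar> powr u)"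
  shows "integrable M (\<lambda>\<omega>. \<bar>X \<omega> + Y \<omega>\<bar> powr u)"
proof (rule Bochner_Integration.integrable_bound)
  show "integrable M (\<lambda>\<omega>. 2 powr u * (1/2 * \<bar>X \<omega>\<bar> powr u + 1/2 * \<bar>Y \<omega>\<bar> powr u))"
    using X Y by (intro integrable_mult_right Bochner_Integration.integrable_add)
  show "AE \<omega> in M. norm (\<bar>X \<omega> + Y \<omega>\<bar> powr u)
      \<le> norm (2 powr u * (1/2 * \<bar>X \<omega>\<bar> powr u + 1/2 * \<bar>Y \<omega>\<bar> powr u))"
  proof (rule AE_I2)
    fix \<omega>
    show "norm (\<bar>X \<omega> + Y \<omega>\<bar> powr u) \<le> norm (2 powr u * (1/2 * \<bar>X \<omega>\<bar> powr u + 1/2 * \<bar>Y \<omega>\<bar> powr u))"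
      using abs_add_powr_le[of 1 1 u "X \<omega>" "Y \<omega>"] u by (simp add: abs_of_nonneg)
  qed
qed simp

lemma moment_triangle_ineq_pos:
  fixes X Y :: "'a \<Rightarrow> real"
  assumes u: "u \<ge> 1" and ab: "a > 0" "b > 0"
    and [measurable]: "X \<in> borel_measurable M" "Y \<in> borel_measurable M"
    and X: "integrable M (\<lambda>\<omega>. \<bar>X \<omega>\<bar> powr u)" "(\<integral>\<omega>. \<bar>X \<omega>\<bar> powr u \<partial>M) \<le> a powr u"
    and Y: "integrable M (\<lambda>\<omega>. \<bar>Y \<omega>\<bar> powr u)" "(\<integral>\<omega>. \<bar>Y \<omega>\<bar> powr u \<partial>M) \<le> b powr u"
  shows "(\<integral>\<omega>. \<bar>X \<omega> + Y \<omega>\<bar> powr u \<partial>M) \<le> (a + b) powr u"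
proof -
  have "(\<integral>\<omega>. \<bar>X \<omega> + Y \<omega>\<bar> powr u \<partial>M) \<le> (\<integral>\<omega>. (a + b) powr u *
      (a / (a + b) * (\<bar>X \<omega>\<bar> powr u / a powr u) + b / (a + b) * (\<bar>Y \<omega>\<bar> powr u / b powr u)) \<partial>M)"
    using u ab X(1) Y(1)
    by (intro integral_mono integrable_abs_add_powr integrable_mult_right
          Bochner_Integration.integrable_add integrable_divide abs_add_powr_le) auto
  also have "\<dots> = (a + b) powr u * (a / (a + b) * ((\<integral>\<omega>. \<bar>X \<omega>\<bar> powr u \<partial>M) / a powr u)
      + b / (a + b) * ((\<integral>\<omega>. \<bar>Y \<omega>\<bar> powr u \<partial>M) / b powr u))"
    using X(1) Y(1) by simp
  also have "\<dots> \<le> (a + b) powr u * (a / (a + b) * 1 + b / (a + b) * 1)"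
    using ab X(2) Y(2) by (intro mult_left_mono add_mono) auto
  also have "a / (a + b) * 1 + b / (a + b) * 1 = 1"
    using ab by (simp add: add_divide_distrib[symmetric])
  finally show ?thesis by simp
qed

text \<open>
  Zero bounds must be allowed, since a variable of norm zero is not excluded. They follow from
  positive ones by continuity.
\<close>

lemma moment_triangle_ineq:
  fixes X Y :: "'a \<Rightarrow> real"
  assumes u: "u \<ge> 1" and ab: "a \<ge> 0" "b \<ge> 0"
    and XY: "X \<in> borel_measurable M" "Y \<in> borel_measurable M"
    and X: "integrable M (\<lambda>\<omega>. \<bar>X \<omega>\<bar> powr u)" "(\<integral>\<omega>. \<bar>X \<omega>\<bar> powr u \<partial>M) \<le> a powr u"
    and Y: "integrable M (\<lambda>\<omega>. \<bar>Y \<omega>\<bar> powr u)" "(\<integral>\<omega>. \<bar>Y \<omega>\<bar> powr u \<partial>M) \<le> b powr u"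
  shows "(\<integral>\<omega>. \<bar>X \<omega> + Y \<omega>\<bar> powr u \<partial>M) \<le> (a + b) powr u"
proof (rule tendsto_lowerbound)
  show "((\<lambda>e. ((a + e) + (b + e)) powr u) \<longlongrightarrow> (a + b) powr u) (at_right 0)"
  proof (rule tendsto_powr')
    show "((\<lambda>e. (a + e) + (b + e)) \<longlongrightarrow> a + b) (at_right 0)"
      by (auto intro!: tendsto_eq_intros)
    show "a + b \<noteq> 0 \<or> u > 0 \<and> (\<forall>\<^sub>F e in at_right 0. 0 \<le> (a + e) + (b + e))"
      using u ab by (auto simp: eventually_at_right_less intro!: eventually_at_rightI[of 0 1])
  qed simp
  show "\<forall>\<^sub>F e in at_right 0. (\<integral>\<omega>. \<bar>X \<omega> + Y \<omega>\<bar> powr u \<partial>M) \<le> ((a + e) + (b + e)) powr u"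
  proof (rule eventually_at_rightI[of 0 1])
    fix e :: real assume "e \<in> {0<..<1}"
    then have e: "e > 0" by simp
    have "a powr u \<le> (a + e) powr u" "b powr u \<le> (b + e) powr u"
      using e ab u by (auto intro!: powr_mono2)
    then show "(\<integral>\<omega>. \<bar>X \<omega> + Y \<omega>\<bar> powr u \<partial>M) \<le> ((a + e) + (b + e)) powr u"
      using e ab X Y by (intro moment_triangle_ineq_pos[OF u _ _ XY]) auto
  qed simp
qed simp

section \<open>Bounds in the space of random variables\<close>

definition psi_bounded :: "'w measure \<Rightarrow> (real \<Rightarrow> real) \<Rightarrow> real \<Rightarrow> ('w \<Rightarrow> real) \<Rightarrow> bool" where
  "psi_bounded M \<psi> K X \<longleftrightarrow> X \<in> borel_measurable M \<and>
     (\<forall>u\<ge>1. integrable M (\<lambda>\<omega>. \<bar>X \<omega>\<bar> powr u) \<and> (\<integral>\<omega>. \<bar>X \<omega>\<bar> powr u \<partial>M) \<le> (K * \<psi> u) powr u)"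

lemma psi_boundedD:
  assumes "psi_bounded M \<psi> K X"
  shows "X \<in> borel_measurable M"
    and "u \<ge> 1 \<Longrightarrow> integrable M (\<lambda>\<omega>. \<bar>X \<omega>\<bar> powr u)"
    and "u \<ge> 1 \<Longrightarrow> (\<integral>\<omega>. \<bar>X \<omega>\<bar> powr u \<partial>M) \<le> (K * \<psi> u) powr u"
  using assms by (auto simp: psi_bounded_def)

lemma psi_norm_nonneg:
  assumes \<psi>: "\<forall>u\<ge>1. \<psi> u > 0" and X: "X \<in> F_psi M \<psi>"
  shows "psi_norm M \<psi> X \<ge> 0"
proof -
  have "0 \<le> (\<integral>\<omega>. \<bar>X \<omega>\<bar> powr 1 \<partial>M) powr (1 / 1) / \<psi> 1"
    using \<psi>[rule_format, of 1] by simp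
  also have "\<dots> \<le> psi_norm M \<psi> X"
    unfolding psi_norm_def using X by (intro cSUP_upper) (auto simp: F_psi_def)
  finally show ?thesis .
qed

lemma psi_bounded_psi_norm:
  assumes \<psi>: "\<forall>u\<ge>1. \<psi> u > 0" and X: "X \<in> F_psi M \<psi>"
  shows "psi_bounded M \<psi> (psi_norm M \<psi> X) X"
  unfolding psi_bounded_def
proof (intro conjI allI impI)
  fix u :: real assume u: "u \<ge> 1"
  let ?m = "\<integral>\<omega>. \<bar>X \<omega>\<bar> powr u \<partial>M"
  have "?m powr (1 / u) / \<psi> u \<le> psi_norm M \<psi> X"
    unfolding psi_norm_def using X u by (intro cSUP_upper) (auto simp: F_psi_def)
  then have "?m powr (1 / u) \<le> psi_norm M \<psi> X * \<psi> u"
    using \<psi>[rule_format, OF u] by (simp add: pos_divide_le_eq)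
  then have "(?m powr (1 / u)) powr u \<le> (psi_norm M \<psi> X * \<psi> u) powr u"
    using u by (intro powr_mono2) auto
  then show "?m \<le> (psi_norm M \<psi> X * \<psi> u) powr u"
    using u by (simp add: powr_powr)
qed (use X in \<open>auto simp: F_psi_def\<close>)

lemma psi_bounded_imp_F_psi:
  assumes \<psi>: "\<forall>u\<ge>1. \<psi> u > 0" and K: "K \<ge> 0" and X: "psi_bounded M \<psi> K X"
  shows "X \<in> F_psi M \<psi>" and "psi_norm M \<psi> X \<le> K"
proof -
  have le: "(\<integral>\<omega>. \<bar>X \<omega>\<bar> powr u \<partial>M) powr (1 / u) / \<psi> u \<le> K" if u: "u \<ge> 1" for u
  proof -
    have "(\<integral>\<omega>. \<bar>X \<omega>\<bar> powr u \<partial>M) powr (1 / u) \<le> ((K * \<psi> u) powr u) powr (1 / u)"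
      using u psi_boundedD(3)[OF X u] by (intro powr_mono2) auto
    also have "\<dots> = K * \<psi> u"
      using u K \<psi>[rule_format, OF u] by (simp add: powr_powr)
    finally show ?thesis
      using \<psi>[rule_format, OF u] by (simp add: pos_divide_le_eq)
  qed
  then show "X \<in> F_psi M \<psi>"
    using psi_boundedD(1,2)[OF X] by (auto simp: F_psi_def intro!: bdd_aboveI[of _ K])
  show "psi_norm M \<psi> X \<le> K"
    unfolding psi_norm_def using le by (intro cSUP_least) auto
qed

lemma psi_bounded_add:
  assumes \<psi>: "\<forall>u\<ge>1. \<psi> u > 0" and KK: "K \<ge> 0" "K' \<ge> 0"
    and X: "psi_bounded M \<psi> K X" and Y: "psi_bounded M \<psi> K' Y"
  shows "psi_bounded M \<psi> (K + K') (\<lambda>\<omega>. X \<omega> + Y \<omega>)"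
  unfolding psi_bounded_def
proof (intro conjI allI impI)
  fix u :: real assume u: "u \<ge> 1"
  show "integrable M (\<lambda>\<omega>. \<bar>X \<omega> + Y \<omega>\<bar> powr u)"
    using u psi_boundedD[OF X] psi_boundedD[OF Y] by (intro integrable_abs_add_powr) auto
  show "(\<integral>\<omega>. \<bar>X \<omega> + Y \<omega>\<bar> powr u \<partial>M) \<le> ((K + K') * \<psi> u) powr u"
    unfolding distrib_right using u KK \<psi>[rule_format, OF u] psi_boundedD[OF X] psi_boundedD[OF Y]
    by (intro moment_triangle_ineq) auto
qed (use psi_boundedD(1)[OF X] psi_boundedD(1)[OF Y] in measurable)

lemma psi_bounded_sum:
  assumes \<psi>: "\<forall>u\<ge>1. \<psi> u > 0" and K: "K \<ge> 0" and "finite A"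
    and "\<And>i. i \<in> A \<Longrightarrow> psi_bounded M \<psi> K (X i)"
  shows "psi_bounded M \<psi> (real (card A) * K) (\<lambda>\<omega>. \<Sum>i\<in>A. X i \<omega>)"
  using assms(3,4)
proof (induction A rule: finite_induct)
  case empty
  then show ?case by (simp add: psi_bounded_def)
next
  case (insert i A)
  then show ?case
    using psi_bounded_add[OF \<psi> K _ insert.prems[of i], of "real (card A) * K"] K
    by (simp add: distrib_right)
qed

text \<open>
  Jensen's inequality bounds every moment of the constant \<open>E X\<close>, which is \<open>\<bar>E X\<bar> powr u\<close>, by the
  moment of \<open>X\<close> of the same order, so the constant inherits the bound of \<open>X\<close>.
\<close>

lemma (in prob_space) psi_bounded_expectation:
  assumes X: "psi_bounded M \<psi> K X"
  shows "psi_bounded M \<psi> K (\<lambda>_. expectation X)"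
  unfolding psi_bounded_def
proof (intro conjI allI impI)
  fix u :: real assume u: "u \<ge> 1"
  have "integrable M (\<lambda>\<omega>. \<bar>X \<omega>\<bar>)"
    using psi_boundedD(2)[OF X, of 1] by simp
  then have "integrable M X"
    using psi_boundedD(1)[OF X] by (simp add: integrable_abs_iff)
  then have "\<bar>expectation X\<bar> powr u \<le> expectation (\<lambda>\<omega>. \<bar>X \<omega>\<bar> powr u)"
    using psi_boundedD(2)[OF X u] convex_on_abs_powr[OF u]
    by (intro jensens_inequality[where I = UNIV]) auto
  also have "\<dots> \<le> (K * \<psi> u) powr u"
    by (rule psi_boundedD(3)[OF X u])
  finally show "expectation (\<lambda>\<omega>. \<bar>expectation X\<bar> powr u) \<le> (K * \<psi> u) powr u"
    by (simp add: prob_space)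
qed auto

lemma (in prob_space) psi_bounded_centred:
  assumes \<psi>: "\<forall>u\<ge>1. \<psi> u > 0" and K: "K \<ge> 0" and X: "psi_bounded M \<psi> K X"
  shows "psi_bounded M \<psi> (2 * K) (\<lambda>\<omega>. X \<omega> - expectation X)"
proof -
  have "psi_bounded M \<psi> K (\<lambda>_. - expectation X)"
    using psi_bounded_expectation[OF X] by (simp add: psi_bounded_def)
  from psi_bounded_add[OF \<psi> K K X this] show ?thesis
    by simp
qed

lemma psi_bounded_distr_iff:
  assumes [measurable]: "X \<in> borel_measurable M"
  shows "psi_bounded M \<psi> K X \<longleftrightarrow> psi_bounded (distr M borel X) \<psi> K (\<lambda>x. x)"
  by (simp add: psi_bounded_def integrable_distr_eq integral_distr)

section \<open>Tail bounds\<close>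

lemma psi_bounded_tail:
  assumes M: "prob_space M" and u: "u \<ge> 1" and c: "c > 0" and X: "psi_bounded M \<psi> K X"
  shows "measure M {\<omega> \<in> space M. \<bar>X \<omega>\<bar> > c} \<le> (K * \<psi> u) powr u / c powr u"
proof -
  interpret prob_space M by fact
  have [measurable]: "X \<in> borel_measurable M"
    by (rule psi_boundedD(1)[OF X])
  have "measure M {\<omega> \<in> space M. \<bar>X \<omega>\<bar> > c} \<le> measure M {\<omega> \<in> space M. \<bar>X \<omega>\<bar> powr u \<ge> c powr u}"
    using c u by (intro finite_measure_mono) (auto intro!: powr_mono2)
  also have "\<dots> \<le> (\<integral>\<omega>. \<bar>X \<omega>\<bar> powr u \<partial>M) / c powr u"
    using psi_boundedD(2)[OF X u] c
    by (intro integral_Markov_inequality_measure[where A = "space M"]) auto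
  also have "\<dots> \<le> (K * \<psi> u) powr u / c powr u"
    using psi_boundedD(3)[OF X u] by (intro divide_right_mono) auto
  finally show ?thesis .
qed

text \<open>
  Condition \<open>H\<close> with a negative \<open>C\<close> is not contradictory: it forces the norms of centred
  variables to vanish.
  The bound is therefore stated with \<open>\<bar>C\<bar>\<close>, which covers both signs.
\<close>

lemma condition_H_sum_bound:
  assumes M: "prob_space M" and \<psi>: "\<forall>u\<ge>1. \<psi> u > 0" and H: "condition_H M \<psi> C"
    and K: "K \<ge> 0" and indep: "prob_space.indep_vars M (\<lambda>_. borel) X {1..n}"
    and X: "\<And>i. i \<in> {1..n} \<Longrightarrow> psi_bounded M \<psi> K (X i)"
    and zero: "\<And>i. i \<in> {1..n} \<Longrightarrow> (\<integral>\<omega>. X i \<omega> \<partial>M) = 0"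
  shows "psi_bounded M \<psi> (sqrt (\<bar>C\<bar> * real n) * K) (\<lambda>\<omega>. \<Sum>i=1..n. X i \<omega>)"
proof -
  let ?S = "\<lambda>\<omega>. \<Sum>i=1..n. X i \<omega>"
  have XF: "X i \<in> F_psi M \<psi>" and XK: "(psi_norm M \<psi> (X i))\<^sup>2 \<le> K\<^sup>2" if "i \<in> {1..n}" for i
    using psi_bounded_imp_F_psi[OF \<psi> K X[OF that]] psi_norm_nonneg[OF \<psi>, of "X i" M]
    by (simp_all add: power_mono)
  \<comment> \<open>This crude bound serves only to show that the norm of the sum is a bounded supremum.\<close>
  have SF: "?S \<in> F_psi M \<psi>"
  proof (rule psi_bounded_imp_F_psi(1)[OF \<psi>])
    show "psi_bounded M \<psi> (real (card {1..n}) * K) ?S"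
      by (rule psi_bounded_sum[OF \<psi> K finite_atLeastAtMost X])
  qed (use K in simp)
  have "(psi_norm M \<psi> ?S)\<^sup>2 \<le> C * (\<Sum>i=1..n. (psi_norm M \<psi> (X i))\<^sup>2)"
    using H XF zero indep unfolding condition_H_def by blast
  also have "\<dots> \<le> \<bar>C\<bar> * (\<Sum>i=1..n. (psi_norm M \<psi> (X i))\<^sup>2)"
    by (intro mult_right_mono sum_nonneg) auto
  also have "\<dots> \<le> \<bar>C\<bar> * (\<Sum>i=1..n. K\<^sup>2)"
    using XK by (intro mult_left_mono sum_mono) auto
  also have "\<dots> = (sqrt (\<bar>C\<bar> * real n) * K)\<^sup>2"
    by (simp add: power_mult_distrib)
  finally have le: "psi_norm M \<psi> ?S \<le> sqrt (\<bar>C\<bar> * real n) * K"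
    by (rule power2_le_imp_le) (use K in simp)
  show ?thesis
    unfolding psi_bounded_def
  proof (intro conjI allI impI)
    fix u :: real assume u: "u \<ge> 1"
    note S = psi_boundedD[OF psi_bounded_psi_norm[OF \<psi> SF]]
    show "integrable M (\<lambda>\<omega>. \<bar>?S \<omega>\<bar> powr u)"
      by (rule S(2)[OF u])
    have "(psi_norm M \<psi> ?S * \<psi> u) powr u \<le> (sqrt (\<bar>C\<bar> * real n) * K * \<psi> u) powr u"
      using u \<psi>[rule_format, OF u] le psi_norm_nonneg[OF \<psi> SF] by (intro powr_mono2 mult_right_mono) auto
    with S(3)[OF u] show "(\<integral>\<omega>. \<bar>?S \<omega>\<bar> powr u \<partial>M) \<le> (sqrt (\<bar>C\<bar> * real n) * K * \<psi> u) powr u"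
      by linarith
  qed (use SF in \<open>simp add: F_psi_def\<close>)
qed

section \<open>Reliability and accuracy of the sample mean\<close>

theorem theorem9p6:
  fixes \<psi> :: "real \<Rightarrow> real"
    and \<mu> P :: "'s measure" and p f :: "'s \<Rightarrow> real"
    and \<Omega> :: "'w measure" and \<xi> :: "nat \<Rightarrow> 'w \<Rightarrow> real" and Z :: "'w \<Rightarrow> real"
    and n :: nat and I C L \<delta> \<epsilon> :: real
  assumes "\<And>u. u \<ge> 1 \<Longrightarrow> \<psi> u > 0"
    and "mono_on {1..} \<psi>"
    and "continuous_on {1..} \<psi>"
    and "filterlim \<psi> at_top at_top"
    and "sigma_finite_measure \<mu>"
    and "p \<in> borel_measurable \<mu>"
    and "\<And>s. s \<in> space \<mu> \<Longrightarrow> p s \<ge> 0"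
    and "(\<integral>s. p s \<partial>\<mu>) = 1"
    and "P = density \<mu> (\<lambda>s. ennreal (p s))"
    and "f \<in> borel_measurable \<mu>"
    and "integrable \<mu> (\<lambda>s. f s * p s)"
    and "I = (\<integral>s. f s * p s \<partial>\<mu>)"
    and "prob_space \<Omega>"
    and "n \<ge> 1"
    and "prob_space.indep_vars \<Omega> (\<lambda>_. borel) \<xi> {1..n}"
    and "\<And>i. i \<in> {1..n} \<Longrightarrow> distr \<Omega> borel (\<xi> i) = distr P borel f"
    and "Z = (\<lambda>\<omega>. (1 / real n) * (\<Sum>i=1..n. \<xi> i \<omega>))"
    and "f \<in> F_psi P \<psi>"
    and "condition_H \<Omega> \<psi> C"
    and "L = psi_norm P \<psi> f * sqrt C"
    and "0 < \<delta>" and "\<delta> < 1" and "\<epsilon> > 0"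
    and "(INF u\<in>{1..}. (2 powr u * L powr u * \<psi> u powr u) / (sqrt (real n) * \<epsilon>) powr u) \<le> \<delta>"
  shows "measure \<Omega> {\<omega> \<in> space \<Omega>. \<bar>Z \<omega> - I\<bar> > \<epsilon>} \<le> \<delta>"
proof -
  have \<psi>: "\<forall>u\<ge>1. \<psi> u > 0"
    using assms(1) by simp
  note f_meas [measurable] = assms(10) and p_meas [measurable] = assms(6)
  interpret prob_space \<Omega> by (rule assms(13))
  define K where "K = psi_norm P \<psi> f"
  have K: "K \<ge> 0"
    unfolding K_def by (rule psi_norm_nonneg[OF \<psi> assms(18)])
  have fP [measurable]: "f \<in> borel_measurable P"
    by (simp add: assms(9))
  have \<xi>_meas [measurable]: "\<xi> i \<in> borel_measurable \<Omega>" if "i \<in> {1..n}" for i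
    using assms(15) that by (simp add: indep_vars_def)

  have \<xi>_bounded: "psi_bounded \<Omega> \<psi> K (\<xi> i)" if i: "i \<in> {1..n}" for i
    using psi_bounded_psi_norm[OF \<psi> assms(18)]
    by (simp add: K_def psi_bounded_distr_iff[OF \<xi>_meas[OF i]] psi_bounded_distr_iff[OF fP] assms(16)[OF i])
  have mean: "expectation (\<xi> i) = I" if i: "i \<in> {1..n}" for i
  proof -
    have "expectation (\<xi> i) = (\<integral>x. x \<partial>distr \<Omega> borel (\<xi> i))"
      using \<xi>_meas[OF i] by (simp add: integral_distr)
    also have "\<dots> = (\<integral>s. f s \<partial>P)"
      by (simp add: assms(16)[OF i] integral_distr)
    also have "\<dots> = (\<integral>s. p s *\<^sub>R f s \<partial>\<mu>)"
      unfolding assms(9) by (rule integral_density) (use assms(7) in auto)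
    finally show ?thesis
      by (simp add: assms(12) mult.commute)
  qed

  define X where "X = (\<lambda>i \<omega>. \<xi> i \<omega> - I)"
  have X_bounded: "psi_bounded \<Omega> \<psi> (2 * K) (X i)" if i: "i \<in> {1..n}" for i
    using psi_bounded_centred[OF \<psi> K \<xi>_bounded[OF i]] by (simp add: X_def mean[OF i])
  have X_zero: "expectation (X i) = 0" if i: "i \<in> {1..n}" for i
  proof -
    have "integrable \<Omega> (\<xi> i)"
      using psi_boundedD(2)[OF \<xi>_bounded[OF i], of 1] \<xi>_meas[OF i] by (simp add: integrable_abs_iff)
    then show ?thesis
      by (simp add: X_def mean[OF i] prob_space)
  qed
  have X_indep: "indep_vars (\<lambda>_. borel) X {1..n}"
    unfolding X_def by (rule indep_vars_compose2[OF assms(15)]) simp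
  define S where "S = (\<lambda>\<omega>. \<Sum>i=1..n. X i \<omega>)"
  have S_bounded: "psi_bounded \<Omega> \<psi> (sqrt (\<bar>C\<bar> * real n) * (2 * K)) S"
    unfolding S_def
    using K by (intro condition_H_sum_bound[OF assms(13) \<psi> assms(19) _ X_indep X_bounded X_zero]) auto

  have n: "real n > 0"
    using assms(14) by simp
  have dev: "\<bar>Z \<omega> - I\<bar> > \<epsilon> \<longleftrightarrow> \<bar>S \<omega>\<bar> > real n * \<epsilon>" for \<omega>
  proof -
    have "S \<omega> = real n * (Z \<omega> - I)"
      using n by (simp add: S_def X_def assms(17) sum_subtractf algebra_simps)
    then show ?thesis
      using n by (simp add: abs_mult)
  qed
  have sqrt_abs: "sqrt \<bar>C\<bar> = \<bar>sqrt C\<bar>"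
    by (cases "C \<ge> 0") (auto simp: real_sqrt_minus)
  have bound: "measure \<Omega> {\<omega> \<in> space \<Omega>. \<bar>Z \<omega> - I\<bar> > \<epsilon>}
      \<le> (2 powr u * L powr u * \<psi> u powr u) / (sqrt (real n) * \<epsilon>) powr u" if u: "u \<ge> 1" for u
  proof -
    have L: "sqrt (\<bar>C\<bar> * real n) * (2 * K) = sqrt (real n) * (2 * \<bar>L\<bar>)"
      using K by (simp add: assms(20) K_def real_sqrt_mult abs_mult sqrt_abs)
    \<comment> \<open>A negative \<open>C\<close> can make \<open>L\<close> negative, but \<open>powr\<close> depends only on the absolute value of its base.\<close>
    have abs_L: "\<bar>L\<bar> powr u = L powr u"
      by (simp add: powr_def abs_if ln_minus)
    have "measure \<Omega> {\<omega> \<in> space \<Omega>. \<bar>Z \<omega> - I\<bar> > \<epsilon>}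
        \<le> (sqrt (\<bar>C\<bar> * real n) * (2 * K) * \<psi> u) powr u / (real n * \<epsilon>) powr u"
      unfolding dev using n assms(23) by (intro psi_bounded_tail[OF assms(13) u _ S_bounded]) simp
    also have "\<dots> = (sqrt (real n) * (2 * \<bar>L\<bar>) * \<psi> u / (sqrt (real n) * (sqrt (real n) * \<epsilon>))) powr u"
      unfolding L by (simp add: powr_divide flip: mult.assoc)
    also have "\<dots> = (2 * \<bar>L\<bar> * \<psi> u / (sqrt (real n) * \<epsilon>)) powr u"
      using n by (simp only: mult.assoc mult_divide_mult_cancel_left_if) simp
    also have "\<dots> = (2 powr u * L powr u * \<psi> u powr u) / (sqrt (real n) * \<epsilon>) powr u"
      by (simp add: powr_divide powr_mult abs_L)
    finally show ?thesis .
  qed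
  have "measure \<Omega> {\<omega> \<in> space \<Omega>. \<bar>Z \<omega> - I\<bar> > \<epsilon>}
      \<le> (INF u\<in>{1..}. (2 powr u * L powr u * \<psi> u powr u) / (sqrt (real n) * \<epsilon>) powr u)"
    using bound by (intro cINF_greatest) auto
  also have "\<dots> \<le> \<delta>"
    by (rule assms(24))
  finally show ?thesis .
qed

end
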